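(* Let $\boldsymbol S=\boldsymbol D+\boldsymbol D^T$ be positive definite with $s_{ij}\le 0$ for all $i\ne j$, with eigenvalues $\lambda_1\ge\cdots\ge\lambda_n>0$, let $\delta_i>0$ for all $i$, and let $L>\lambda_1$. Let $\boldsymbol p^\infty\in\mathbb R^n$ satisfy the first-order stationarity condition $\boldsymbol p^\infty\in\mathcal H_{k,\boldsymbol p^0,\boldsymbol\delta}\big(\boldsymbol p^\infty-\frac1L\nabla\mathcal Q(\boldsymbol p^\infty)\big)$. Let $\sigma^\infty=\{i \mid p_i^\infty\ne p_i^0\}$ and $\kappa=|\sigma^\infty|$. Let $\boldsymbol q^\infty=\boldsymbol p^\infty-\frac1L\nabla\mathcal Q(\boldsymbol p^\infty)$, $\Delta_i^\infty=(p_i^0-q_i^\infty)^2-d(q_i^\infty,\mathcal P^i_{\delta_i})$ for $i=1,\dots,n$, and let $\Delta^\infty_{(1)}\ge\Delta^\infty_{(2)}\ge\cdots\ge\Delta^\infty_{(n)}$ be the values $\Delta^\infty_i$ in nonincreasing order. Then the following two statements hold. (i) $$\|\nabla\mathcal Q(\boldsymbol p^\infty)\|_2^2\ \le\ L^2\sum_{i=\kappa+1}^n\Delta^\infty_{(i)}+\frac14L^2\sum_{i=1}^n\delta_i^2.$$ (ii) $$\mathcal Q(\boldsymbol p^\infty)-\mathcal Q^*\ \le\ \frac{L^2}{2\lambda_n}\sum_{i=\kappa+1}^n\Delta^\infty_{(i)}+\frac{L^2}{8\lambda_n}\sum_{i=1}^n\delta_i^2.$$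
   Context: Let $n\ge1$ and $k\ge 0$ be integers, $\boldsymbol a,\boldsymbol c,\boldsymbol p^0,\boldsymbol\delta\in\mathbb R^n$, $\boldsymbol D\in\mathbb R^{n\times n}$, and $\boldsymbol S=\boldsymbol D+\boldsymbol D^T=(s_{ij})$. Define $\mathcal Q(\boldsymbol p)=\frac12\boldsymbol p^T\boldsymbol S\boldsymbol p-(\boldsymbol a+\boldsymbol D^T\boldsymbol c)^T\boldsymbol p$. For each $i$, $\mathcal P^i_{\delta_i}=\{p_i^0\}\cup[p_i^0+\delta_i,\infty)\cup(-\infty,p_i^0-\delta_i]$; $\mathcal P_{\boldsymbol\delta}=\mathcal P^1_{\delta_1}\times\cdots\times\mathcal P^n_{\delta_n}$; $d(q_i,\mathcal P^i_{\delta_i})=\min_{p_i\in\mathcal P^i_{\delta_i}}(p_i-q_i)^2$. The feasible set is $\Omega_{k,\boldsymbol p^0,\boldsymbol\delta}=\{\boldsymbol p\in\mathbb R^n\mid\|\boldsymbol p-\boldsymbol p^0\|_0\le k,\ \boldsymbol p\in\mathcal P_{\boldsymbol\delta}\}$, where $\|\cdot\|_0$ counts nonzero entries. $\mathcal H_{k,\boldsymbol p^0,\boldsymbol\delta}(\boldsymbol q)=\arg\min_{\boldsymbol p\in\Omega_{k,\boldsymbol p^0,\boldsymbol\delta}}\|\boldsymbol p-\boldsymbol q\|_2^2$ is the set of all Euclidean projections of $\boldsymbol q$ onto the feasible set. $\mathcal Q^*$ is the optimal value of $\min\{\mathcal Q(\boldsymbol p)\mid\boldsymbol p\in\Omega_{k,\boldsymbol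 p^0,\boldsymbol\delta}\}$. *)

theory Defs
  imports "HOL-Analysis.Analysis"
begin

definition pos_def :: "real^'n^'n \<Rightarrow> bool" where
  "pos_def M \<longleftrightarrow> transpose M = M \<and> (\<forall>x. x \<noteq> 0 \<longrightarrow> 0 < x \<bullet> (M *v x))"

(* lam 1 \<ge> ... \<ge> lam n are the eigenvalues of M, counted with algebraic multiplicity:
   the characteristic polynomial of M splits with exactly these roots.
   Values of lam outside {1..n} are irrelevant. *)
definition ordered_eigenvalues :: "real^'n^'n \<Rightarrow> (nat \<Rightarrow> real) \<Rightarrow> bool" where
  "ordered_eigenvalues M lam \<longleftrightarrow>
     (\<forall>t. det (mat t - M) = (\<Prod>i\<in>{1..CARD('n)}. t - lam i)) \<and>
     antimono_on {1..CARD('n)} lam"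

definition gradient :: "('a::real_inner \<Rightarrow> real) \<Rightarrow> 'a \<Rightarrow> 'a" where
  "gradient f x = (THE g. GDERIV f x :> g)"

(* The m-th largest entry x_(m), m = 1, ..., n, entries counted with repetition. *)
definition nth_largest :: "real^'n \<Rightarrow> nat \<Rightarrow> real" where
  "nth_largest x m =
     rev (sorted_list_of_multiset (image_mset (\<lambda>i. x $ i) (mset_set UNIV))) ! (m - 1)"

definition l0norm :: "real^'n \<Rightarrow> nat" where
  "l0norm x = card {i. x $ i \<noteq> 0}"

definition Qobj :: "real^'n^'n \<Rightarrow> real^'n \<Rightarrow> real^'n \<Rightarrow> real^'n \<Rightarrow> real" where
  "Qobj D a c p =
     1/2 * (p \<bullet> ((D + transpose D) *v p)) - (a + transpose D *v c) \<bullet> p"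

definition Pcoord :: "real \<Rightarrow> real \<Rightarrow> real set" where
  "Pcoord p0 \<delta> = {p0} \<union> {p0 + \<delta>..} \<union> {..p0 - \<delta>}"

definition Pbox :: "real^'n \<Rightarrow> real^'n \<Rightarrow> (real^'n) set" where
  "Pbox p0 \<delta> = {p. \<forall>i. p $ i \<in> Pcoord (p0 $ i) (\<delta> $ i)}"

(* A squared distance; the infimum is attained for every nonempty closed A. *)
definition sqdist :: "real \<Rightarrow> real set \<Rightarrow> real" where
  "sqdist q A = (INF p\<in>A. (p - q)\<^sup>2)"

definition feasible :: "nat \<Rightarrow> real^'n \<Rightarrow> real^'n \<Rightarrow> (real^'n) set" where
  "feasible k p0 \<delta> = {p. l0norm (p - p0) \<le> k \<and> p \<in> Pbox p0 \<delta>}"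

definition Hproj :: "nat \<Rightarrow> real^'n \<Rightarrow> real^'n \<Rightarrow> real^'n \<Rightarrow> (real^'n) set" where
  "Hproj k p0 \<delta> q =
     {p. is_arg_min (\<lambda>p. (norm (p - q))\<^sup>2) (\<lambda>p. p \<in> feasible k p0 \<delta>) p}"

(* Real-valued infimum: meaningful when the objective is bounded below on the feasible set,
   in particular when D + transpose D is positive definite, where it is attained. *)
definition Qopt ::
  "real^'n^'n \<Rightarrow> real^'n \<Rightarrow> real^'n \<Rightarrow> nat \<Rightarrow> real^'n \<Rightarrow> real^'n \<Rightarrow> real" where
  "Qopt D a c k p0 \<delta> = (INF p\<in>feasible k p0 \<delta>. Qobj D a c p)"

end

theory Submission
  imports Defs
begin

text \<open>
  With \<open>q = p - g/L\<close> one has \<open>\<parallel>g\<parallel>\<^sup>2 = L\<^sup>2 \<parallel>p - q\<parallel>\<^sup>2\<close>. Let \<open>T\<close> collect the indices of the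
  \<open>\<kappa>\<close> largest \<open>\<Delta>\<^sub>i\<close>. Projecting \<open>q\<close> coordinatewise inside \<open>T\<close> and putting \<open>p\<^sup>0\<close> outside \<open>T\<close>
  gives a feasible competitor, as \<open>\<kappa> \<le> k\<close>; its squared distance to \<open>q\<close> is the sum of all
  coordinate distances, each at most \<open>\<delta>\<^sub>i\<^sup>2/4\<close> since the gaps of the coordinate sets have length
  \<open>\<delta>\<^sub>i\<close>, plus the sum of \<open>\<Delta>\<^sub>i\<close> outside \<open>T\<close>. This bounds \<open>\<parallel>p - q\<parallel>\<^sup>2\<close>.
  The second bound follows from the first because strong convexity with constant \<open>\<lambda>\<^sub>n\<close> yields
  \<open>Q p - Q x \<le> \<parallel>g\<parallel>\<^sup>2 / (2 \<lambda>\<^sub>n)\<close> for every \<open>x\<close>.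
\<close>

section \<open>Squared distances on the line and the gaps of the coordinate sets\<close>

lemma sqdist_attained:
  assumes "closed A" "A \<noteq> {}"
  obtains r where "r \<in> A" "sqdist q A = (r - q)\<^sup>2"
proof -
  obtain r where r: "r \<in> A" "\<And>y. y \<in> A \<Longrightarrow> dist q r \<le> dist q y"
    using distance_attains_inf[OF assms, of q] by metis
  have "(r - q)\<^sup>2 \<le> (y - q)\<^sup>2" if "y \<in> A" for y
    using r(2)[OF that] by (simp add: dist_real_def abs_le_square_iff power2_commute)
  then have "sqdist q A = (r - q)\<^sup>2"
    unfolding sqdist_def by (intro cInf_eq_minimum) (use r(1) in auto)
  with r(1) show thesis by (rule that)
qed

lemma sqdist_le:
  assumes "r \<in> A"
  shows "sqdist q A \<le> (r - q)\<^sup>2"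
  unfolding sqdist_def
  by (rule cINF_lower[OF _ assms]) (auto intro!: bdd_belowI[of _ 0])

lemma sqdist_Pcoord_le:
  assumes "0 < d"
  shows "sqdist q (Pcoord p0 d) \<le> d\<^sup>2 / 4"
proof -
  have "\<exists>r\<in>Pcoord p0 d. \<bar>r - q\<bar> \<le> \<bar>d / 2\<bar>"
  proof -
    consider "\<bar>p0 - q\<bar> \<le> d / 2" | "q > p0 + d / 2" | "q < p0 - d / 2"
      by linarith
    then show ?thesis
    proof cases
      case 1
      then show ?thesis by (intro bexI[of _ p0]) (auto simp: Pcoord_def)
    next
      case 2
      then show ?thesis
        \<comment> \<open>Beyond the midpoint of the right gap, the witness is \<open>q\<close>
          itself if it has left the gap, and otherwise the endpoint \<open>p0 + d\<close>, less than
          \<open>d / 2\<close> away. The next case mirrors this.\<close>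
        using assms by (intro bexI[of _ "max q (p0 + d)"]) (auto simp: Pcoord_def max_def)
    next
      case 3
      then show ?thesis
        using assms by (intro bexI[of _ "min q (p0 - d)"]) (auto simp: Pcoord_def min_def)
    qed
  qed
  then obtain r where r: "r \<in> Pcoord p0 d" "(r - q)\<^sup>2 \<le> (d / 2)\<^sup>2"
    by (auto simp only: abs_le_square_iff)
  with sqdist_le[OF r(1), of q] show ?thesis
    by (simp add: power_divide)
qed

section \<open>Coordinate sums and order statistics\<close>

lemma norm_squared_vec: "(norm v)\<^sup>2 = (\<Sum>i\<in>UNIV. (v $ i)\<^sup>2)" for v :: "real^'n"
  by (simp add: power2_norm_eq_inner inner_vec_def flip: power2_eq_square)

text \<open>Sorting the indices, rather than the values, lets \<open>T\<close> be the first \<kappa>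
  indices of the sorted list; ties are broken by the sort.\<close>

lemma sum_nth_largest:
  fixes x :: "real^'n"
  assumes "\<kappa> \<le> CARD('n)"
  obtains T :: "'n set"
  where "card T = \<kappa>" "(\<Sum>i = \<kappa> + 1..CARD('n). nth_largest x i) = (\<Sum>i\<in>-T. x $ i)"
proof -
  obtain xs :: "'n list" where xs: "set xs = UNIV" "distinct xs"
    using finite_distinct_list[of "UNIV :: 'n set"] by auto
  define ys where "ys = rev (sort_key (\<lambda>i. x $ i) xs)"
  have ys: "set ys = UNIV" "distinct ys" using xs by (auto simp: ys_def)
  have len: "length ys = CARD('n)"
    using ys distinct_card by fastforce
  have "mset ys = mset_set UNIV"
    using mset_set_set[OF ys(2)] ys(1) by simp
  then have "image_mset (\<lambda>i. x $ i) (mset_set UNIV) = mset (map (\<lambda>i. x $ i) (rev ys))"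
    by simp
  moreover have "sorted (map (\<lambda>i. x $ i) (rev ys))"
    by (simp add: ys_def)
  ultimately have sl: "rev (sorted_list_of_multiset (image_mset (\<lambda>i. x $ i) (mset_set UNIV)))
      = map (\<lambda>i. x $ i) ys"
    by (simp only: sorted_list_of_multiset_mset sorted_sort_id) (simp add: rev_map)
  let ?T = "set (take \<kappa> ys)"
  have "card ?T = \<kappa>"
    using ys assms len by (simp add: distinct_card)
  have split: "set (take \<kappa> ys) \<union> set (drop \<kappa> ys) = UNIV" "set (take \<kappa> ys) \<inter> set (drop \<kappa> ys) = {}"
    using ys set_append[of "take \<kappa> ys" "drop \<kappa> ys"] distinct_append[of "take \<kappa> ys" "drop \<kappa> ys"]
    by simp_all
  then have compl: "set (drop \<kappa> ys) = -?T" by blast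
  \<comment> \<open>Ranks start at 1 and list positions at 0, hence the shift by one.\<close>
  have "(\<Sum>i = \<kappa> + 1..CARD('n). nth_largest x i) = (\<Sum>j = \<kappa>..<CARD('n). map (\<lambda>i. x $ i) ys ! j)"
    by (rule sum.reindex_bij_witness[of _ Suc "\<lambda>i. i - 1"]) (auto simp: nth_largest_def sl)
  also have "\<dots> = (\<Sum>j = 0..<CARD('n) - \<kappa>. drop \<kappa> (map (\<lambda>i. x $ i) ys) ! j)"
    by (rule sum.reindex_bij_witness[of _ "\<lambda>j. j + \<kappa>" "\<lambda>j. j - \<kappa>"]) (use len assms in \<open>auto simp: add.commute\<close>)
  also have "\<dots> = sum_list (map (\<lambda>i. x $ i) (drop \<kappa> ys))"
    using len by (simp add: sum_list_sum_nth drop_map)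
  also have "\<dots> = (\<Sum>i\<in>-?T. x $ i)"
    using sum_list_distinct_conv_sum_set[of "drop \<kappa> ys" "\<lambda>i. x $ i"] ys(2) compl by simp
  finally show thesis using that \<open>card ?T = \<kappa>\<close> by blast
qed

section \<open>Spectral lower bound for the quadratic form\<close>

lemma ordered_eigenvalues_antimono:
  assumes "ordered_eigenvalues (M :: real^'n^'n) lam" "1 \<le> i" "i \<le> j" "j \<le> CARD('n)"
  shows "lam j \<le> lam i"
  using assms by (auto simp: ordered_eigenvalues_def monotone_on_def)

lemma inner_symmetric_matrix:
  fixes M :: "real^'n^'n"
  assumes "transpose M = M"
  shows "x \<bullet> (M *v y) = y \<bullet> (M *v x)"
  using dot_lmul_matrix[of x M y] assms by (metis transpose_matrix_vector inner_commute)

text \<open>Moving from \<open>x\<close> by \<open>t\<close> times \<open>w = M *v x\<close> changes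
  the form by a quadratic in \<open>t\<close> with linear coefficient
  \<open>2 * (w \<bullet> w)\<close>. It can stay nonnegative for all \<open>t\<close> only if
  \<open>w\<close> vanishes.\<close>

lemma psd_null_vector:
  fixes M :: "real^'n^'n"
  assumes sym: "transpose M = M" and psd: "\<And>y. 0 \<le> y \<bullet> (M *v y)" and x: "x \<bullet> (M *v x) = 0"
  shows "M *v x = 0"
proof -
  let ?w = "M *v x"
  let ?b = "?w \<bullet> (M *v ?w)"
  have xw: "x \<bullet> (M *v ?w) = ?w \<bullet> ?w"
    by (rule inner_symmetric_matrix[OF sym])
  have expand: "0 \<le> 2 * t * (?w \<bullet> ?w) + t\<^sup>2 * ?b" for t :: real
    using psd[of "x + t *\<^sub>R ?w"] x xw
    by (simp add: matrix_vector_mult_add_rdistrib matrix_vector_right_distrib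
        matrix_vector_mult_scaleR inner_add_left inner_add_right power2_eq_square algebra_simps)
  have "?w \<bullet> ?w \<le> 0"
  proof (cases "?b = 0")
    case True
    then show ?thesis using expand[of "-1"] by simp
  next
    case False
    then have b: "?b > 0" using psd[of ?w] by linarith
    \<comment> \<open>The chosen \<open>t\<close> minimizes the quadratic, and this is its minimum
      value.\<close>
    have "0 \<le> - (?w \<bullet> ?w)\<^sup>2 / ?b"
      using expand[of "- (?w \<bullet> ?w) / ?b"] b by (simp add: field_simps power2_eq_square)
    then show ?thesis using b by (simp add: field_simps)
  qed
  then show ?thesis
    by (metis inner_eq_zero_iff inner_ge_zero order_antisym)
qed

text \<open>The minimum \<mu> of the form on the unit sphere is attained at some \<open>x\<close>.
  Then \<open>M - mat \<mu>\<close> is positive semidefinite and its form vanishes at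
  \<open>x\<close>, so \<open>x\<close> lies in its kernel. Hence \<mu> is a root of the
  characteristic polynomial and is at least the last eigenvalue.\<close>

lemma ordered_eigenvalues_Rayleigh:
  fixes M :: "real^'n^'n"
  assumes sym: "transpose M = M" and ev: "ordered_eigenvalues M lam"
  shows "lam CARD('n) * (y \<bullet> y) \<le> y \<bullet> (M *v y)"
proof -
  let ?f = "\<lambda>x. x \<bullet> (M *v x)"
  have "continuous_on (sphere 0 1) ?f"
    by (intro continuous_intros matrix_vector_mult_linear_continuous_on)
  moreover have "sphere (0::real^'n) 1 \<noteq> {}"
    by (simp add: sphere_eq_empty)
  ultimately obtain x where x: "x \<in> sphere 0 1" "\<And>y. y \<in> sphere 0 1 \<Longrightarrow> ?f x \<le> ?f y"
    using continuous_attains_inf[of "sphere 0 1" ?f] compact_sphere by blast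
  define \<mu> where "\<mu> = ?f x"
  have bound: "\<mu> * (y \<bullet> y) \<le> ?f y" for y
  proof (cases "y = 0")
    case False
    let ?u = "y /\<^sub>R norm y"
    have "\<mu> \<le> ?f ?u" unfolding \<mu>_def using False by (intro x(2)) auto
    also have "?f ?u = ?f y / (norm y)\<^sup>2"
      by (simp add: matrix_vector_mult_scaleR power2_eq_square divide_inverse)
    finally show ?thesis
      using False by (simp add: field_simps power2_norm_eq_inner)
  qed simp
  let ?N = "M - mat \<mu>"
  have mat: "(mat \<mu> :: real^'n^'n) *v z = \<mu> *\<^sub>R z" for z
    by (simp add: vec_eq_iff matrix_vector_mult_def mat_def if_distribR if_distrib[of "\<lambda>x. x * _"] cong: if_cong)
  have N: "z \<bullet> (?N *v z) = ?f z - \<mu> * (z \<bullet> z)" for z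
    by (simp add: matrix_vector_mult_diff_rdistrib mat inner_diff_right)
  have "transpose ?N = ?N"
    using sym by (simp add: vec_eq_iff transpose_def mat_def)
  moreover have "x \<bullet> x = 1" using x(1) by (simp add: norm_eq_1)
  then have "x \<bullet> (?N *v x) = 0" by (simp add: N flip: \<mu>_def)
  ultimately have "?N *v x = 0"
    using bound by (intro psd_null_vector) (auto simp: N)
  then have "(mat \<mu> - M) *v x = 0"
    by (simp add: matrix_vector_mult_diff_rdistrib)
  moreover have "x \<noteq> 0" using x(1) by auto
  ultimately have "det (mat \<mu> - M) = 0"
    by (metis invertible_det_nz invertible_left_inverse matrix_left_invertible_ker)
  then obtain i where "i \<in> {1..CARD('n)}" "\<mu> = lam i"
    using ev by (auto simp: ordered_eigenvalues_def)
  then have "lam CARD('n) \<le> \<mu>"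
    using ordered_eigenvalues_antimono[OF ev, of i "CARD('n)"] by simp
  then have "lam CARD('n) * (y \<bullet> y) \<le> \<mu> * (y \<bullet> y)"
    by (intro mult_right_mono) auto
  then show ?thesis using bound[of y] by linarith
qed

section \<open>Gradient and strong convexity of the objective\<close>

lemma gradient_eqI: "GDERIV f x :> g \<Longrightarrow> gradient f x = g"
  unfolding gradient_def
proof (rule the_equality)
  fix h assume "GDERIV f x :> g" "GDERIV f x :> h"
  then have "(\<lambda>v. v \<bullet> h) = (\<lambda>v. v \<bullet> g)"
    unfolding gderiv_def by (rule has_derivative_unique[rotated])
  then show "h = g"
    by (simp add: fun_eq_iff vector_eq_ldot)
qed

text \<open>This is the exact second-order Taylor formula; symmetry of
  \<open>D + transpose D\<close> merges the two cross terms.\<close>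

lemma Qobj_expand:
  fixes D :: "real^'n^'n"
  shows "Qobj D a c (p + h) = Qobj D a c p
    + h \<bullet> ((D + transpose D) *v p - (a + transpose D *v c)) + 1/2 * (h \<bullet> ((D + transpose D) *v h))"
proof -
  let ?S = "D + transpose D"
  have "p \<bullet> (?S *v h) = h \<bullet> (?S *v p)"
    by (rule inner_symmetric_matrix) (simp add: vec_eq_iff transpose_def)
  moreover have "(a + transpose D *v c) \<bullet> h = h \<bullet> (a + transpose D *v c)"
    by (rule inner_commute)
  ultimately show ?thesis
    unfolding Qobj_def matrix_vector_right_distrib[of ?S] inner_add_right[of "a + _"] inner_diff_right
    unfolding inner_add_left[of p h]
    unfolding inner_add_right[of _ "?S *v _"]
    by (simp add: algebra_simps)
qed

lemma gradient_Qobj: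
  "gradient (Qobj D a c) p = (D + transpose D) *v p - (a + transpose D *v c)"
proof (rule gradient_eqI)
  let ?S = "D + transpose D"
  have sym: "p \<bullet> (?S *v h) = h \<bullet> (?S *v p)" for h
    by (rule inner_symmetric_matrix) (simp add: vec_eq_iff transpose_def)
  have S: "((*v) ?S has_derivative (*v) ?S) (at p)"
    by (intro bounded_linear_imp_has_derivative matrix_vector_mul_bounded_linear)
  have "(Qobj D a c has_derivative
      (\<lambda>h. 1/2 * (p \<bullet> (?S *v h) + h \<bullet> (?S *v p)) - (a + transpose D *v c) \<bullet> h)) (at p)"
    unfolding Qobj_def by (auto intro!: derivative_eq_intros S)
  then show "GDERIV (Qobj D a c) p :> ?S *v p - (a + transpose D *v c)"
    unfolding gderiv_def sym
    by (simp only: inner_diff_right inner_commute[of "a + transpose D *v c"]) simp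
qed

lemma Qobj_gap_le:
  fixes D :: "real^'n^'n"
  assumes coercive: "\<And>y. m * (y \<bullet> y) \<le> y \<bullet> ((D + transpose D) *v y)" and "0 < m"
  shows "Qobj D a c p - Qobj D a c x \<le> (norm (gradient (Qobj D a c) p))\<^sup>2 / (2 * m)"
proof -
  let ?g = "gradient (Qobj D a c) p"
  let ?h = "x - p"
  have "Qobj D a c x - Qobj D a c p \<ge> ?h \<bullet> ?g + m / 2 * (?h \<bullet> ?h)"
    using Qobj_expand[of D a c p ?h] coercive[of ?h] by (simp add: gradient_Qobj)
  \<comment> \<open>Completing the square: the lower bound
    \<open>h \<bullet> g + m / 2 * (h \<bullet> h)\<close> differs from this nonnegative term by
    exactly \<open>(g \<bullet> g) / (2 * m)\<close>.\<close>
  moreover have "0 \<le> (m *\<^sub>R ?h + ?g) \<bullet> (m *\<^sub>R ?h + ?g) / (2 * m)"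
    using \<open>0 < m\<close> by simp
  moreover have "(m *\<^sub>R h + g) \<bullet> (m *\<^sub>R h + g) / (2 * m)
      = m / 2 * (h \<bullet> h) + h \<bullet> g + (g \<bullet> g) / (2 * m)" for h g :: "real^'n"
    using \<open>0 < m\<close>
    by (simp add: inner_add_left inner_add_right inner_commute[of g h] field_simps)
  ultimately show ?thesis
    by (simp add: power2_norm_eq_inner)
qed

section \<open>Comparison of the projection with a feasible competitor, and the two bounds\<close>

lemma Hproj_dist_le:
  fixes p0 \<delta> q p \<Delta> :: "real^'n"
  assumes p: "p \<in> Hproj k p0 \<delta> q"
    and T: "card T \<le> k"
    and \<Delta>: "\<And>i. \<Delta> $ i = (p0 $ i - q $ i)\<^sup>2 - sqdist (q $ i) (Pcoord (p0 $ i) (\<delta> $ i))"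
  shows "(norm (p - q))\<^sup>2
    \<le> (\<Sum>i\<in>-T. \<Delta> $ i) + (\<Sum>i\<in>UNIV. sqdist (q $ i) (Pcoord (p0 $ i) (\<delta> $ i)))"
proof -
  let ?d = "\<lambda>i. sqdist (q $ i) (Pcoord (p0 $ i) (\<delta> $ i))"
  have "\<exists>r. r \<in> Pcoord (p0 $ i) (\<delta> $ i) \<and> ?d i = (r - q $ i)\<^sup>2" for i
    by (rule sqdist_attained[of "Pcoord (p0 $ i) (\<delta> $ i)" "q $ i"])
      (auto simp: Pcoord_def intro!: closed_Un closed_insert)
  then obtain r where r: "\<And>i. r i \<in> Pcoord (p0 $ i) (\<delta> $ i)" "\<And>i. ?d i = (r i - q $ i)\<^sup>2"
    by metis
  define y :: "real^'n" where "y = (\<chi> i. if i \<in> T then r i else p0 $ i)"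
  have "l0norm (y - p0) \<le> card T"
    unfolding l0norm_def by (rule card_mono) (auto simp: y_def)
  then have "y \<in> feasible k p0 \<delta>"
    using T r(1) by (auto simp: feasible_def Pbox_def y_def Pcoord_def)
  then have "(norm (p - q))\<^sup>2 \<le> (norm (y - q))\<^sup>2"
    using p by (auto simp: Hproj_def is_arg_min_linorder)
  \<comment> \<open>Inside \<open>T\<close> the competitor pays only the coordinate distance;
    keeping \<open>p0 $ i\<close> outside \<open>T\<close> costs \<open>\<Delta> $ i\<close>
    more.\<close>
  also have "\<dots> = (\<Sum>i\<in>UNIV. (if i \<in> -T then \<Delta> $ i else 0) + ?d i)"
    unfolding norm_squared_vec by (intro sum.cong) (auto simp: y_def \<Delta> r(2))
  also have "\<dots> = (\<Sum>i\<in>-T. \<Delta> $ i) + (\<Sum>i\<in>UNIV. ?d i)"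
    by (simp add: sum.distrib sum.If_cases Compl_eq)
  finally show ?thesis .
qed

theorem proposition17:
  fixes D S :: "real^'n^'n"
    and a c p0 \<delta> pinf qinf \<Delta> :: "real^'n"
    and k \<kappa> :: nat
    and L :: real
    and lam :: "nat \<Rightarrow> real"
    and \<sigma> :: "'n set"
  assumes S: "S = D + transpose D"
    and "pos_def S"
    and "\<And>i j. i \<noteq> j \<Longrightarrow> S $ i $ j \<le> 0"
    and "ordered_eigenvalues S lam"
    and "0 < lam CARD('n)"
    and "\<And>i. 0 < \<delta> $ i"
    and "lam 1 < L"
    and stationary:
      "pinf \<in> Hproj k p0 \<delta> (pinf - (1/L) *\<^sub>R gradient (Qobj D a c) pinf)"
    and \<sigma>: "\<sigma> = {i. pinf $ i \<noteq> p0 $ i}"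
    and \<kappa>: "\<kappa> = card \<sigma>"
    and qinf: "qinf = pinf - (1/L) *\<^sub>R gradient (Qobj D a c) pinf"
    and \<Delta>: "\<And>i. \<Delta> $ i = (p0 $ i - qinf $ i)\<^sup>2 - sqdist (qinf $ i) (Pcoord (p0 $ i) (\<delta> $ i))"
  shows "(norm (gradient (Qobj D a c) pinf))\<^sup>2
           \<le> L\<^sup>2 * (\<Sum>i = \<kappa> + 1..CARD('n). nth_largest \<Delta> i)
             + 1/4 * L\<^sup>2 * (\<Sum>i\<in>UNIV. (\<delta> $ i)\<^sup>2)
       \<and> Qobj D a c pinf - Qopt D a c k p0 \<delta>
           \<le> L\<^sup>2 / (2 * lam CARD('n)) * (\<Sum>i = \<kappa> + 1..CARD('n). nth_largest \<Delta> i)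
             + L\<^sup>2 / (8 * lam CARD('n)) * (\<Sum>i\<in>UNIV. (\<delta> $ i)\<^sup>2)"
proof -
  let ?g = "gradient (Qobj D a c) pinf"
  let ?rest = "\<Sum>i = \<kappa> + 1..CARD('n). nth_largest \<Delta> i"
  let ?m = "lam CARD('n)"
  have m: "0 < ?m" by fact
  have "?m \<le> lam 1"
    using ordered_eigenvalues_antimono[OF \<open>ordered_eigenvalues S lam\<close>, of 1 "CARD('n)"]
    by (simp add: Suc_leI)
  then have L: "0 < L" using m \<open>lam 1 < L\<close> by linarith
  have proj: "pinf \<in> Hproj k p0 \<delta> qinf" using stationary qinf by simp
  \<comment> \<open>Since \<kappa> equals \<open>l0norm (pinf - p0)\<close>, feasibility of
    \<open>pinf\<close> makes an index set of size \<kappa> admissible for the competitor.\<close>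
  then have "l0norm (pinf - p0) \<le> k"
    by (simp add: Hproj_def is_arg_min_def feasible_def)
  then have "\<kappa> \<le> k" by (simp add: \<kappa> \<sigma> l0norm_def)
  have "\<kappa> \<le> CARD('n)" unfolding \<kappa> by (rule card_mono) auto
  then obtain T :: "'n set" where T: "card T = \<kappa>" "?rest = (\<Sum>i\<in>-T. \<Delta> $ i)"
    by (rule sum_nth_largest)
  have "(norm (pinf - qinf))\<^sup>2
      \<le> ?rest + (\<Sum>i\<in>UNIV. sqdist (qinf $ i) (Pcoord (p0 $ i) (\<delta> $ i)))"
    unfolding T(2) using T(1) \<open>\<kappa> \<le> k\<close> by (intro Hproj_dist_le[OF proj] \<Delta>) simp
  also have "\<dots> \<le> ?rest + (\<Sum>i\<in>UNIV. (\<delta> $ i)\<^sup>2 / 4)"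
    by (intro add_left_mono sum_mono sqdist_Pcoord_le) (rule \<open>\<And>i. 0 < \<delta> $ i\<close>)
  also have "\<dots> = ?rest + 1/4 * (\<Sum>i\<in>UNIV. (\<delta> $ i)\<^sup>2)"
    by (simp add: sum_divide_distrib)
  finally have "L\<^sup>2 * (norm (pinf - qinf))\<^sup>2 \<le> L\<^sup>2 * (?rest + 1/4 * (\<Sum>i\<in>UNIV. (\<delta> $ i)\<^sup>2))"
    by (rule mult_left_mono) simp
  \<comment> \<open>Solving the definition of \<open>qinf\<close> for the gradient turns the
    distance bound into a gradient bound.\<close>
  moreover have "?g = L *\<^sub>R (pinf - qinf)"
    using L by (simp add: qinf)
  then have "(norm ?g)\<^sup>2 = L\<^sup>2 * (norm (pinf - qinf))\<^sup>2"
    by (simp only: norm_scaleR power_mult_distrib power2_abs)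
  ultimately have i: "(norm ?g)\<^sup>2 \<le> L\<^sup>2 * ?rest + 1/4 * L\<^sup>2 * (\<Sum>i\<in>UNIV. (\<delta> $ i)\<^sup>2)"
    by (simp add: algebra_simps)
  have gap: "Qobj D a c pinf - Qobj D a c x \<le> (norm ?g)\<^sup>2 / (2 * ?m)" for x
    using ordered_eigenvalues_Rayleigh[of S lam] \<open>pos_def S\<close> \<open>ordered_eigenvalues S lam\<close> m
    by (intro Qobj_gap_le) (auto simp: pos_def_def S)
  \<comment> \<open>The feasible set is nonempty, so the lower bound from \<open>gap\<close>, valid
    at every point, passes to the real infimum \<open>Qopt\<close>.\<close>
  have "p0 \<in> feasible k p0 \<delta>"
    by (simp add: feasible_def l0norm_def Pbox_def Pcoord_def)
  then have "Qobj D a c pinf - (norm ?g)\<^sup>2 / (2 * ?m) \<le> Qopt D a c k p0 \<delta>"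
    unfolding Qopt_def by (intro cINF_greatest) (use gap in \<open>auto simp: algebra_simps\<close>)
  moreover have "(norm ?g)\<^sup>2 / (2 * ?m)
      \<le> (L\<^sup>2 * ?rest + 1/4 * L\<^sup>2 * (\<Sum>i\<in>UNIV. (\<delta> $ i)\<^sup>2)) / (2 * ?m)"
    using i m by (intro divide_right_mono) auto
  moreover have "\<dots> = L\<^sup>2 / (2 * ?m) * ?rest + L\<^sup>2 / (8 * ?m) * (\<Sum>i\<in>UNIV. (\<delta> $ i)\<^sup>2)"
    using m by (simp add: field_simps)
  ultimately show ?thesis using i by linarith
qed

end
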